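(* Let the number of UEs in the cell change from $M_1$ to $M_2$ after time slot $n_1$, and suppose that all UEs then present rebid for resources and that the distributed resource allocation algorithm reaches a steady state at $n_1$ (with $M_1$ UEs) and again at $n_2>n_1$ (with $M_2$ UEs). Then the allocated rates and the pledged bids remain optimal: the steady state rates $r_i(n_1)$ and bids $w_i(n_1)$, $i=1,\dots,M_1$, are optimal for the cell with $M_1$ UEs, and the steady state rates $r_i(n_2)$ and bids $w_i(n_2)$, $i=1,\dots,M_2$, are optimal for the cell with $M_2$ UEs.
   Context: A base station (eNB) with total rate $R>0$ serves $M$ user equipments (UEs). UE $i$ has a subscription weight $\beta_i>0$ and an aggregated utility function $V_i:[0,\infty)\to[0,\infty)$ of its total rate $r_i$, obtained from the utilities $U_{ij}$ and usage percentages $\alpha_{ij}>0$, $\sum_j\alpha_{ij}=1$, of its applications as $V_i(r_i)=\prod_j U_{ij}(r_{ij})^{\alpha_{ij}}$ with $r_i=\sum_j r_{ij}$, the rate $r_i$ being split optimally among the applications. Standing facts: $V_i>0$ on $(0,\infty)$, $V_i(0)=0$, and $\log V_i$ is differentiable and strictly concave on $(0,\infty)$. The slope curvature function is $S_i(r)=\beta_i\frac{d}{dr}\log V_i(r)$, $r>0$, which is strictly decreasing; $S_i^{-1}$ is its inverse on its range. Optimality: the rates $(r_1,\dots,r_M)$ are optimal for the cell with $M$ UEs if they maximize $\prod_{i=1}^M V_i(r_i)^{\beta_i}$ subject to $\sum_{i=1}^M r_i\le R$ and $r_i\ge 0$. Bids $(w_1,\dots,w_M)$ are optimal if $w_i=p^*r_i^*$,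 where $(r_i^* )$ are the optimal rates and $p^*$ is the Lagrange multiplier of the constraint $\sum_i r_i\le R$ for the problem of maximizing $\sum_i\beta_i\log V_i(r_i)$ (the optimal shadow price). Distributed algorithm: each bidding UE $i$ receives the current shadow price $p>0$ from the eNB, computes the rate $S_i^{-1}(p)$ and sends the bid $w_i=p\,S_i^{-1}(p)$; the eNB updates the shadow price as the sum of the bids divided by $R$. A steady state at time $n$ with $M$ UEs all (re)bidding means: $p(n)>0$ with $p(n)=\frac1R\sum_{i=1}^{M}w_i(n)$, $r_i(n)=S_i^{-1}(p(n))$ and $w_i(n)=p(n)S_i^{-1}(p(n))$ for all $i=1,\dots,M$. *)

theory Defs
  imports "HOL-Analysis.Analysis"
begin

definition strictly_concave_on :: "real set \<Rightarrow> (real \<Rightarrow> real) \<Rightarrow> bool" where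
  "strictly_concave_on A f \<longleftrightarrow> convex A \<and>
     (\<forall>x\<in>A. \<forall>y\<in>A. \<forall>t. x \<noteq> y \<longrightarrow> 0 < t \<longrightarrow> t < 1 \<longrightarrow>
        (1 - t) * f x + t * f y < f ((1 - t) * x + t * y))"

text \<open>
  User equipments are numbered from 1, and so are the \<open>N\<close> applications of a user equipment,
  which have utilities \<open>U j\<close> and usage percentages \<open>\<alpha> j\<close>. Functions on
  \<open>[0,\<infinity>)\<close> are functions on the reals whose values at negative arguments are
  irrelevant. Since \<open>0 powr a = 0\<close>, the products below vanish as soon as one of the
  factors has base 0.
\<close>

definition application_product ::
    "nat \<Rightarrow> (nat \<Rightarrow> real) \<Rightarrow> (nat \<Rightarrow> real \<Rightarrow> real) \<Rightarrow> (nat \<Rightarrow> real) \<Rightarrow> real" where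
  "application_product N \<alpha> U x = (\<Prod>j=1..N. U j (x j) powr \<alpha> j)"

definition optimal_split ::
    "nat \<Rightarrow> (nat \<Rightarrow> real) \<Rightarrow> (nat \<Rightarrow> real \<Rightarrow> real) \<Rightarrow> real \<Rightarrow> (nat \<Rightarrow> real) \<Rightarrow> bool" where
  "optimal_split N \<alpha> U \<rho> x \<longleftrightarrow>
     is_arg_max (application_product N \<alpha> U)
       (\<lambda>x. (\<forall>j\<in>{1..N}. 0 \<le> x j) \<and> (\<Sum>j=1..N. x j) = \<rho>) x"

definition aggregated_utility ::
    "nat \<Rightarrow> (nat \<Rightarrow> real) \<Rightarrow> (nat \<Rightarrow> real \<Rightarrow> real) \<Rightarrow> (real \<Rightarrow> real) \<Rightarrow> bool" where
  "aggregated_utility N \<alpha> U V \<longleftrightarrow>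
     (\<forall>\<rho>\<ge>0. \<exists>x. optimal_split N \<alpha> U \<rho> x \<and> V \<rho> = application_product N \<alpha> U x)"

definition user_equipment ::
    "real \<Rightarrow> nat \<Rightarrow> (nat \<Rightarrow> real) \<Rightarrow> (nat \<Rightarrow> real \<Rightarrow> real) \<Rightarrow> (real \<Rightarrow> real) \<Rightarrow> bool" where
  "user_equipment \<beta> N \<alpha> U V \<longleftrightarrow>
     \<beta> > 0 \<and>
     (\<forall>j\<in>{1..N}. \<alpha> j > 0) \<and> (\<Sum>j=1..N. \<alpha> j) = 1 \<and>
     (\<forall>j\<in>{1..N}. \<forall>\<rho>\<ge>0. U j \<rho> \<ge> 0) \<and>
     aggregated_utility N \<alpha> U V \<and>
     V 0 = 0 \<and> (\<forall>\<rho>>0. V \<rho> > 0) \<and>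
     (\<lambda>\<rho>. ln (V \<rho>)) differentiable_on {0<..} \<and>
     strictly_concave_on {0<..} (\<lambda>\<rho>. ln (V \<rho>))"

definition slope_curvature :: "real \<Rightarrow> (real \<Rightarrow> real) \<Rightarrow> real \<Rightarrow> real" where
  "slope_curvature \<beta> V \<rho> = \<beta> * deriv (\<lambda>x. ln (V x)) \<rho>"

text \<open>Meaningful only for arguments in the range \<open>slope_curvature \<beta> V ` {0<..}\<close>.\<close>

definition slope_curvature_inv :: "real \<Rightarrow> (real \<Rightarrow> real) \<Rightarrow> real \<Rightarrow> real" where
  "slope_curvature_inv \<beta> V = the_inv_into {0<..} (slope_curvature \<beta> V)"

definition optimal_rates ::
    "real \<Rightarrow> nat \<Rightarrow> (nat \<Rightarrow> real) \<Rightarrow> (nat \<Rightarrow> real \<Rightarrow> real) \<Rightarrow> (nat \<Rightarrow> real) \<Rightarrow> bool" where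
  "optimal_rates R M \<beta> V r \<longleftrightarrow>
     is_arg_max (\<lambda>r. \<Prod>i=1..M. V i (r i) powr \<beta> i)
       (\<lambda>r. (\<Sum>i=1..M. r i) \<le> R \<and> (\<forall>i\<in>{1..M}. 0 \<le> r i)) r"

definition lagrangian ::
    "real \<Rightarrow> nat \<Rightarrow> (nat \<Rightarrow> real) \<Rightarrow> (nat \<Rightarrow> real \<Rightarrow> real) \<Rightarrow> (nat \<Rightarrow> real) \<Rightarrow> real \<Rightarrow> real" where
  "lagrangian R M \<beta> V r p =
     (\<Sum>i=1..M. \<beta> i * ln (V i (r i))) - p * ((\<Sum>i=1..M. r i) - R)"

text \<open>
  \<open>p\<close> is a Lagrange multiplier of the constraint \<open>(\<Sum>i=1..M. r i) \<le> R\<close>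
  at the feasible point \<open>r\<close>. The Lagrangian is maximized over positive rates because
  \<open>log (V i 0) = -\<infinity>\<close>, whereas \<open>ln 0 = 0\<close> in HOL. As the maximization is over
  an open set, the stationarity conditions \<open>slope_curvature (\<beta> i) (V i) (r i) = p\<close>
  follow, so \<open>p\<close> is unique when \<open>M > 0\<close>.
\<close>

definition lagrange_multiplier ::
    "real \<Rightarrow> nat \<Rightarrow> (nat \<Rightarrow> real) \<Rightarrow> (nat \<Rightarrow> real \<Rightarrow> real) \<Rightarrow> (nat \<Rightarrow> real) \<Rightarrow> real \<Rightarrow> bool" where
  "lagrange_multiplier R M \<beta> V r p \<longleftrightarrow>
     p \<ge> 0 \<and>
     is_arg_max (\<lambda>r. lagrangian R M \<beta> V r p) (\<lambda>r. \<forall>i\<in>{1..M}. 0 < r i) r \<and>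
     p * ((\<Sum>i=1..M. r i) - R) = 0"

definition optimal_bids ::
    "real \<Rightarrow> nat \<Rightarrow> (nat \<Rightarrow> real) \<Rightarrow> (nat \<Rightarrow> real \<Rightarrow> real) \<Rightarrow> (nat \<Rightarrow> real) \<Rightarrow> bool" where
  "optimal_bids R M \<beta> V w \<longleftrightarrow>
     (\<exists>r p. optimal_rates R M \<beta> V r \<and> lagrange_multiplier R M \<beta> V r p \<and>
        (\<forall>i\<in>{1..M}. w i = p * r i))"

text \<open>
  Here \<open>p\<close>, \<open>r\<close> and \<open>w\<close> are the shadow price, the rates and the bids of one time slot.
  Membership of \<open>p\<close> in the ranges says that the algorithm can evaluate the inverses.
\<close>

definition steady_state ::
    "real \<Rightarrow> nat \<Rightarrow> (nat \<Rightarrow> real) \<Rightarrow> (nat \<Rightarrow> real \<Rightarrow> real) \<Rightarrow>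
     real \<Rightarrow> (nat \<Rightarrow> real) \<Rightarrow> (nat \<Rightarrow> real) \<Rightarrow> bool" where
  "steady_state R M \<beta> V p r w \<longleftrightarrow>
     p > 0 \<and> p = (\<Sum>i=1..M. w i) / R \<and>
     (\<forall>i\<in>{1..M}. p \<in> slope_curvature (\<beta> i) (V i) ` {0<..} \<and>
        r i = slope_curvature_inv (\<beta> i) (V i) p \<and>
        w i = p * slope_curvature_inv (\<beta> i) (V i) p)"

end

(* Strict concavity of ln V makes the slope curvature injective, so at a steady state the price p is
   the slope curvature of every user equipment at its rate, and the price update says that the rates
   sum up to R. The tangent line inequality, summed over the user equipments, then shows that the
   rates maximize the Lagrangian, and weak duality gives optimality of the rates. *)

theory Submission
  imports Defs
begin

text \<open>The library tangent bound for convex functions is weak, so it is applied to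
  \<open>- f\<close> at the midpoint \<open>m\<close> of \<open>x\<close> and \<open>y\<close>.
  Strict concavity puts \<open>f m\<close> strictly above the average of \<open>f x\<close> and
  \<open>f y\<close>, and this makes the bound at \<open>y\<close> strict.\<close>

lemma strictly_concave_on_below_tangent:
  fixes f :: "real \<Rightarrow> real"
  assumes conc: "strictly_concave_on A f" and x: "x \<in> interior A" and y: "y \<in> A" "y \<noteq> x"
    and der: "(f has_real_derivative D) (at x)"
  shows "f y < f x + D * (y - x)"
proof -
  define m where "m = (1 - 1/2) * x + (1/2) * y"
  have A: "convex A" "x \<in> A"
    using conc x interior_subset by (auto simp: strictly_concave_on_def)
  have m: "m \<in> A"
    unfolding m_def using convexD_alt[OF A y(1), of "1/2"] by simp
  have cv: "convex_on A (\<lambda>x. - f x)"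
  proof (rule convex_onI)
    fix t u v :: real
    assume t: "0 < t" "t < 1" and uv: "u \<in> A" "v \<in> A"
    show "- f ((1 - t) *\<^sub>R u + t *\<^sub>R v) \<le> (1 - t) * - f u + t * - f v"
    proof (cases "u = v")
      case True
      \<comment> \<open>Strict concavity speaks only of distinct points, hence the case
        split.\<close>
      then show ?thesis by (simp add: algebra_simps)
    next
      case False
      then have "(1 - t) * f u + t * f v < f ((1 - t) * u + t * v)"
        using conc t uv unfolding strictly_concave_on_def by blast
      then show ?thesis by simp
    qed
  qed (rule A)
  have "((\<lambda>x. - f x) has_real_derivative - D) (at x within A)"
    using DERIV_minus[OF der] has_field_derivative_at_within by blast
  from convex_on_imp_above_tangent[OF cv convex_connected[OF A(1)] x m this]
  have "f m \<le> f x + D * (m - x)" by simp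
  also have "D * (m - x) = D * (y - x) / 2"
    by (simp add: m_def field_simps)
  finally have "f m \<le> f x + D * (y - x) / 2" .
  moreover have "t > 0 \<Longrightarrow> t < 1 \<Longrightarrow> (1 - t) * f x + t * f y < f ((1 - t) * x + t * y)" for t
    using conc A(2) y unfolding strictly_concave_on_def by metis
  from this[of "1/2"] have "f x / 2 + f y / 2 < f m"
    by (simp add: m_def)
  ultimately show ?thesis by simp
qed

lemma user_equipment_below_tangent:
  assumes ue: "user_equipment \<beta> N \<alpha> U V" and "x > 0" "y > 0" "y \<noteq> x"
  shows "\<beta> * ln (V y) < \<beta> * ln (V x) + slope_curvature \<beta> V x * (y - x)"
proof -
  have "(\<lambda>\<rho>. ln (V \<rho>)) differentiable at x"
    using ue \<open>x > 0\<close>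
    by (metis user_equipment_def differentiable_on_eq_differentiable_at greaterThan_iff
        open_greaterThan)
  then have der: "((\<lambda>\<rho>. ln (V \<rho>)) has_real_derivative deriv (\<lambda>\<rho>. ln (V \<rho>)) x) (at x)"
    using DERIV_deriv_iff_real_differentiable by blast
  have "ln (V y) < ln (V x) + deriv (\<lambda>\<rho>. ln (V \<rho>)) x * (y - x)"
    using ue assms(2-4)
    by (intro strictly_concave_on_below_tangent[OF _ _ _ _ der, of "{0<..}"])
       (auto simp: user_equipment_def interior_open)
  moreover have "\<beta> > 0" using ue by (simp add: user_equipment_def)
  ultimately have "\<beta> * ln (V y) < \<beta> * (ln (V x) + deriv (\<lambda>\<rho>. ln (V \<rho>)) x * (y - x))"
    by simp
  then show ?thesis by (simp add: slope_curvature_def algebra_simps)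
qed

text \<open>If two distinct points had the same slope, adding the strict tangent inequalities at
  both would give 0 < 0.\<close>

lemma slope_curvature_inj_on:
  assumes ue: "user_equipment \<beta> N \<alpha> U V"
  shows "inj_on (slope_curvature \<beta> V) {0<..}"
proof (rule inj_onI, rule ccontr)
  fix x y
  assume *: "x \<in> {0<..}" "y \<in> {0<..}" "slope_curvature \<beta> V x = slope_curvature \<beta> V y" "x \<noteq> y"
  show False
    using user_equipment_below_tangent[OF ue, of x y] user_equipment_below_tangent[OF ue, of y x] *
    by (simp add: algebra_simps)
qed

text \<open>Injectivity makes \<open>the_inv_into\<close> a genuine inverse on the range.\<close>

lemma slope_curvature_inv:
  assumes "user_equipment \<beta> N \<alpha> U V" and "p \<in> slope_curvature \<beta> V ` {0<..}"
  shows "slope_curvature_inv \<beta> V p > 0"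
    and "slope_curvature \<beta> V (slope_curvature_inv \<beta> V p) = p"
  using the_inv_into_into[OF slope_curvature_inj_on[OF assms(1)] assms(2) order_refl]
    f_the_inv_into_f[OF slope_curvature_inj_on[OF assms(1)] assms(2)]
  by (simp_all add: slope_curvature_inv_def)

text \<open>By concavity, stationarity suffices for a global maximum: every term lies below its
  tangent of slope \<open>p\<close>, so moving from \<open>r\<close> to \<open>s\<close> gains at
  most \<open>p\<close> times the change of the total rate, which is exactly what the price term
  takes back.\<close>

lemma lagrange_multiplierI:
  assumes ue: "\<And>i. i \<in> {1..M} \<Longrightarrow> user_equipment (\<beta> i) (N i) (\<alpha> i) (U i) (V i)"
    and pos: "\<And>i. i \<in> {1..M} \<Longrightarrow> r i > 0"
    and slope: "\<And>i. i \<in> {1..M} \<Longrightarrow> slope_curvature (\<beta> i) (V i) (r i) = p"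
    and "p \<ge> 0" and "(\<Sum>i=1..M. r i) = R"
  shows "lagrange_multiplier R M \<beta> V r p"
proof -
  have "lagrangian R M \<beta> V s p \<le> lagrangian R M \<beta> V r p" if s: "\<forall>i\<in>{1..M}. 0 < s i" for s
  proof -
    have "(\<Sum>i=1..M. \<beta> i * ln (V i (s i)))
        \<le> (\<Sum>i=1..M. \<beta> i * ln (V i (r i)) + p * (s i - r i))"
    proof (rule sum_mono)
      fix i assume i: "i \<in> {1..M}"
      show "\<beta> i * ln (V i (s i)) \<le> \<beta> i * ln (V i (r i)) + p * (s i - r i)"
        using user_equipment_below_tangent[OF ue[OF i] pos[OF i], of "s i"] s i slope[OF i]
        by (cases "s i = r i") auto
    qed
    then show ?thesis
      by (simp add: lagrangian_def sum.distrib sum_subtractf algebra_simps flip: sum_distrib_left)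
  qed
  then show ?thesis
    unfolding lagrange_multiplier_def is_arg_max_linorder using assms(2,4,5) by simp
qed

text \<open>Weak duality: the price term vanishes at \<open>r\<close> by complementary slackness and
  can only raise the Lagrangian at a feasible \<open>s\<close>.\<close>

lemma lagrange_multiplier_imp_optimal_rates:
  assumes ue: "\<And>i. i \<in> {1..M} \<Longrightarrow> user_equipment (\<beta> i) (N i) (\<alpha> i) (U i) (V i)"
    and lm: "lagrange_multiplier R M \<beta> V r p" and feas: "(\<Sum>i=1..M. r i) \<le> R"
  shows "optimal_rates R M \<beta> V r"
proof -
  let ?F = "\<lambda>r. \<Prod>i=1..M. V i (r i) powr \<beta> i"
  have V: "V i 0 = 0" "x > 0 \<Longrightarrow> V i x > 0" if "i \<in> {1..M}" for i x
    using ue[OF that] by (auto simp: user_equipment_def)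
  \<comment> \<open>Positivity matters: at rate 0 the factor on the left is 0, while
    \<open>ln 0 = 0\<close> would turn the one on the right into 1.\<close>
  have F: "?F s = exp (\<Sum>i=1..M. \<beta> i * ln (V i (s i)))" if s: "\<forall>i\<in>{1..M}. 0 < s i" for s
  proof -
    have "?F s = (\<Prod>i=1..M. exp (\<beta> i * ln (V i (s i))))"
    proof (rule prod.cong)
      fix i assume "i \<in> {1..M}"
      then have "V i (s i) > 0" using V s by blast
      then show "V i (s i) powr \<beta> i = exp (\<beta> i * ln (V i (s i)))"
        by (simp add: powr_def)
    qed simp
    then show ?thesis by (simp add: exp_sum)
  qed
  have r: "\<forall>i\<in>{1..M}. 0 < r i" and "p \<ge> 0" and compl: "p * ((\<Sum>i=1..M. r i) - R) = 0"
    and lmax: "\<And>s. \<forall>i\<in>{1..M}. 0 < s i \<Longrightarrow> lagrangian R M \<beta> V s p \<le> lagrangian R M \<beta> V r p"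
    using lm unfolding lagrange_multiplier_def is_arg_max_linorder by blast+
  have "?F s \<le> ?F r" if s: "(\<Sum>i=1..M. s i) \<le> R" "\<forall>i\<in>{1..M}. 0 \<le> s i" for s
  \<comment> \<open>A feasible point with a zero rate lies outside the domain of the Lagrangian
    maximization; there the product is 0 and is compared directly.\<close>
  proof (cases "\<exists>i\<in>{1..M}. s i = 0")
    case True
    then have "\<exists>i\<in>{1..M}. V i (s i) powr \<beta> i = 0"
      using V(1) by (metis powr_eq_0_iff)
    then have "?F s = 0" by (intro prod_zero) auto
    then show ?thesis by (metis prod_nonneg powr_ge_zero)
  next
    case False
    then have pos: "\<forall>i\<in>{1..M}. 0 < s i" using s(2) by (auto simp: order_less_le)
    have "p * ((\<Sum>i=1..M. s i) - R) \<le> 0"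
      using s(1) \<open>p \<ge> 0\<close> by (simp add: mult_nonneg_nonpos)
    then have "(\<Sum>i=1..M. \<beta> i * ln (V i (s i))) \<le> (\<Sum>i=1..M. \<beta> i * ln (V i (r i)))"
      using lmax[OF pos] compl unfolding lagrangian_def by linarith
    then show ?thesis unfolding F[OF pos] F[OF r] by simp
  qed
  then show ?thesis
    unfolding optimal_rates_def is_arg_max_linorder using r feas by (simp add: less_imp_le)
qed

lemma steady_state_optimal:
  assumes "R > 0"
    and ue: "\<And>i. i \<in> {1..M} \<Longrightarrow> user_equipment (\<beta> i) (N i) (\<alpha> i) (U i) (V i)"
    and ss: "steady_state R M \<beta> V p r w"
  shows "optimal_rates R M \<beta> V r \<and> optimal_bids R M \<beta> V w"
proof -
  have "p > 0" and p: "p = (\<Sum>i=1..M. w i) / R"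
    and inv: "\<And>i. i \<in> {1..M} \<Longrightarrow> p \<in> slope_curvature (\<beta> i) (V i) ` {0<..} \<and>
      r i = slope_curvature_inv (\<beta> i) (V i) p \<and> w i = p * slope_curvature_inv (\<beta> i) (V i) p"
    using ss unfolding steady_state_def by blast+
  have r: "r i > 0 \<and> slope_curvature (\<beta> i) (V i) (r i) = p" if "i \<in> {1..M}" for i
    using slope_curvature_inv[OF ue[OF that], of p] inv[OF that] by metis
  have w: "w i = p * r i" if "i \<in> {1..M}" for i
    using inv[OF that] by metis
  have "p * R = (\<Sum>i=1..M. w i)"
    using p \<open>R > 0\<close> by (metis less_irrefl nonzero_eq_divide_eq)
  also have "\<dots> = p * (\<Sum>i=1..M. r i)"
    using w by (simp add: sum_distrib_left)
  finally have "p * R = p * (\<Sum>i=1..M. r i)" .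
  \<comment> \<open>The capacity is used up exactly, which yields both feasibility and complementary
    slackness.\<close>
  then have sum: "(\<Sum>i=1..M. r i) = R" using \<open>p > 0\<close> by simp
  have lm: "lagrange_multiplier R M \<beta> V r p"
    using ue r \<open>p > 0\<close> sum by (intro lagrange_multiplierI) auto
  have "optimal_rates R M \<beta> V r"
    using lagrange_multiplier_imp_optimal_rates[OF ue lm] sum by simp
  \<comment> \<open>The steady state price is itself the multiplier, so \<open>r\<close> and
    \<open>p\<close> witness the optimality of the bids.\<close>
  with lm w show ?thesis unfolding optimal_bids_def by blast
qed

theorem mainTheorem3:
  fixes R :: real
    and \<beta> :: "nat \<Rightarrow> real" and N :: "nat \<Rightarrow> nat"
    and \<alpha> :: "nat \<Rightarrow> nat \<Rightarrow> real" and U :: "nat \<Rightarrow> nat \<Rightarrow> real \<Rightarrow> real"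
    and V :: "nat \<Rightarrow> real \<Rightarrow> real"
    and M :: "nat \<Rightarrow> nat" and M1 M2 n1 n2 :: nat
    and p :: "nat \<Rightarrow> real" and r w :: "nat \<Rightarrow> nat \<Rightarrow> real"
  assumes "R > 0"
    and "\<And>i. i \<in> {1..max M1 M2} \<Longrightarrow> user_equipment (\<beta> i) (N i) (\<alpha> i) (U i) (V i)"
    and "n1 < n2"
    and "M n1 = M1" and "\<And>n. n1 < n \<Longrightarrow> n \<le> n2 \<Longrightarrow> M n = M2" and "M1 \<noteq> M2"
    and "steady_state R (M n1) \<beta> V (p n1) (\<lambda>i. r i n1) (\<lambda>i. w i n1)"
    and "steady_state R (M n2) \<beta> V (p n2) (\<lambda>i. r i n2) (\<lambda>i. w i n2)"
  shows "optimal_rates R M1 \<beta> V (\<lambda>i. r i n1) \<and> optimal_bids R M1 \<beta> V (\<lambda>i. w i n1) \<and>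
         optimal_rates R M2 \<beta> V (\<lambda>i. r i n2) \<and> optimal_bids R M2 \<beta> V (\<lambda>i. w i n2)"
proof -
  have M: "M n1 = M1" "M n2 = M2" using assms(3-5) by auto
  \<comment> \<open>A steady state concerns a single slot, so the two slots are treated separately;
    the users of each lie in \<open>{1..max M1 M2}\<close>.\<close>
  have "optimal_rates R M1 \<beta> V (\<lambda>i. r i n1) \<and> optimal_bids R M1 \<beta> V (\<lambda>i. w i n1)"
    by (rule steady_state_optimal[OF assms(1) assms(2) assms(7)[unfolded M]]) (simp add: le_max_iff_disj)
  moreover have "optimal_rates R M2 \<beta> V (\<lambda>i. r i n2) \<and> optimal_bids R M2 \<beta> V (\<lambda>i. w i n2)"
    by (rule steady_state_optimal[OF assms(1) assms(2) assms(8)[unfolded M]]) (simp add: le_max_iff_disj)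
  ultimately show ?thesis by blast
qed

end
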